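(* Let $\Gamma$ be a partial geometry $pg(s,t,\alpha)$ with point set $\mathcal{P}$, $|\mathcal{P}|=v$, identified with $[v]$, and line set $\mathcal{L}$, and suppose $t>s$. Then $\mathcal{L}$ (each line viewed as the $(s+1)$-subset of its points) is a resolving set for the Kneser graph $K(v,s+1)$.
   Context: A partial geometry $pg(s,t,\alpha)$ consists of a finite set of points $\mathcal{P}$ and a set of lines $\mathcal{L}$, each line being a set of points, such that: (i) every line has $s+1$ points and two lines meet in at most one point; (ii) every point lies on $t+1$ lines and two points lie on at most one common line; (iii) if a point $p$ is not on a line $L$, exactly $\alpha$ points of $L$ are collinear with $p$. The Kneser graph $K(n,k)$ has as vertices the $k$-subsets of $[n]$, adjacent when disjoint. A resolving set is a set $\mathcal{S}$ of vertices such that for all distinct vertices $U,W$ some $X\in\mathcal{S}$ has $d(U,X)\neq d(W,X)$, where $d$ is graph distance. *)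

theory Defs
  imports "Graph_Theory.Pair_Digraph" "Graph_Theory.Shortest_Path"
begin

locale partial_geometry =
  fixes points :: "'a set" and lines :: "'a set set" and s t \<alpha> :: nat
  assumes finite_points: "finite points"
    and line_subset: "l \<in> lines \<Longrightarrow> l \<subseteq> points"
    and card_line: "l \<in> lines \<Longrightarrow> card l = s + 1"
    and lines_meet: "\<lbrakk>l \<in> lines; m \<in> lines; l \<noteq> m\<rbrakk> \<Longrightarrow> card (l \<inter> m) \<le> 1"
    and card_lines_through: "p \<in> points \<Longrightarrow> card {l \<in> lines. p \<in> l} = t + 1"
    and points_join: "\<lbrakk>p \<in> points; q \<in> points; p \<noteq> q\<rbrakk> \<Longrightarrow>
      card {l \<in> lines. p \<in> l \<and> q \<in> l} \<le> 1"
    and card_collinear: "\<lbrakk>p \<in> points; l \<in> lines; p \<notin> l\<rbrakk> \<Longrightarrow>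
      card {q \<in> l. \<exists>m \<in> lines. p \<in> m \<and> q \<in> m} = \<alpha>"

text \<open>An undirected graph is represented by a symmetric digraph: every edge gives
  rise to a pair of opposite arcs.\<close>

definition kneser_graph :: "nat \<Rightarrow> nat \<Rightarrow> nat set pair_pre_digraph" where
  "kneser_graph n k =
    (let V = {A. A \<subseteq> {1..n} \<and> card A = k}
     in \<lparr> pverts = V, parcs = {(A, B). A \<in> V \<and> B \<in> V \<and> A \<inter> B = {}} \<rparr>)"

lemma pverts_kneser_graph: "pverts (kneser_graph n k) = {A. A \<subseteq> {1..n} \<and> card A = k}"
  unfolding kneser_graph_def Let_def by (rule pair_pre_digraph.simps)

lemma parcs_kneser_graph:
  "(A, B) \<in> parcs (kneser_graph n k) \<longleftrightarrow>
    A \<in> pverts (kneser_graph n k) \<and> B \<in> pverts (kneser_graph n k) \<and> A \<inter> B = {}"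
  unfolding kneser_graph_def Let_def pair_pre_digraph.simps mem_Collect_eq case_prod_conv
  by (rule refl)

lemma kneser_graph_bidirected:
  assumes "k > 0"
  shows "pair_bidirected_digraph (kneser_graph n k)"
proof unfold_locales
  fix e assume e: "e \<in> parcs (kneser_graph n k)"
  obtain A B where AB: "e = (A, B)" by (cases e)
  note h = e[unfolded AB parcs_kneser_graph]
  show "fst e \<in> pverts (kneser_graph n k)" unfolding AB fst_conv using h by blast
  show "snd e \<in> pverts (kneser_graph n k)" unfolding AB snd_conv using h by blast
next
  fix e assume e: "e \<in> parcs (kneser_graph n k)"
  obtain A B where AB: "e = (A, B)" by (cases e)
  note h = e[unfolded AB parcs_kneser_graph pverts_kneser_graph]
  then show "fst e \<noteq> snd e" unfolding AB fst_conv snd_conv using assms by force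
next
  have "sym (parcs (kneser_graph n k))"
    by (rule symI) (unfold parcs_kneser_graph, blast)
  then show "symmetric (with_proj (kneser_graph n k))"
    unfolding symmetric_def with_proj_simps .
qed

text \<open>Least number of edges on a walk; it is \<open>\<infinity>\<close> if there is no walk. The constant
  \<open>wf_digraph.\<mu>\<close> has its intended meaning for well-formed digraphs only.\<close>

definition graph_dist :: "'a pair_pre_digraph \<Rightarrow> 'a \<Rightarrow> 'a \<Rightarrow> ereal" where
  "graph_dist G u w = wf_digraph.\<mu> (with_proj G) (\<lambda>_. 1) u w"

definition resolving_set :: "'a pair_pre_digraph \<Rightarrow> 'a set \<Rightarrow> bool" where
  "resolving_set G S \<longleftrightarrow> S \<subseteq> pverts G \<and>
    (\<forall>u \<in> pverts G. \<forall>w \<in> pverts G. u \<noteq> w \<longrightarrow>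
      (\<exists>x \<in> S. graph_dist G u x \<noteq> graph_dist G w x))"

end

theory Submission
  imports Defs
begin

text \<open>Vertices at distance 1 are exactly the disjoint ones
  (\<open>graph_dist_kneser_adjacent_iff\<close>), so distinct U and W are resolved by any line that
  misses W and meets U. Since U and W have equal size, some point p lies in U but not in W. The t +
  1 lines through p pairwise share no other point, so the s + 1 \<le> t points of W cannot block
  them all (\<open>line_through_point_avoiding_set\<close>).\<close>

lemma wf_digraph_kneser_graph: "wf_digraph (with_proj (kneser_graph n k))"
  by unfold_locales (auto simp: kneser_graph_def Let_def)

text \<open>Distance 1 means adjacency. With \<open>k > 0\<close> this also covers A = B: the
  distance is then at most 0, and a nonempty set is not disjoint from itself.\<close>

lemma graph_dist_kneser_adjacent_iff:
  assumes "k > 0"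
    and A: "A \<in> pverts (kneser_graph n k)" and B: "B \<in> pverts (kneser_graph n k)"
  shows "graph_dist (kneser_graph n k) A B = 1 \<longleftrightarrow> A \<inter> B = {}"
proof -
  define G where "G = kneser_graph n k"
  interpret wf_digraph "with_proj G"
    unfolding G_def by (rule wf_digraph_kneser_graph)
  have dist_le: "graph_dist G A B \<le> length p" if "awalk A p B" for p
    using min_cost_le_walk_cost[OF that, of "\<lambda>_. 1"]
    by (simp add: graph_dist_def awalk_cost_def sum_list_triv)
  \<comment> \<open>The distance is an infimum over walks, so this bound holds even if no walk joins
    A to B and the distance is \<infinity>.\<close>
  have dist_ge: "graph_dist G A B \<ge> n" if "\<And>p. awalk A p B \<Longrightarrow> n \<le> length p" for n :: nat
    using that unfolding graph_dist_def \<mu>_def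
    by (auto simp: awalk_cost_def sum_list_triv intro!: INF_greatest)
  show ?thesis
  proof (cases "A = B")
    case True
    have "graph_dist G A B \<le> 0"
      using dist_le[of "[]"] A[folded G_def] True by (simp add: awalk_Nil_iff zero_ereal_def)
    moreover have "A \<noteq> {}"
      using A \<open>k > 0\<close> by (auto simp: pverts_kneser_graph)
    ultimately show ?thesis
      using True by (auto simp: G_def)
  next
    case False
    have pos: "p \<noteq> []" if "awalk A p B" for p
      using that False by (auto simp: awalk_Nil_iff)
    show ?thesis
    proof (cases "A \<inter> B = {}")
      case True
      then have "(A, B) \<in> parcs G"
        using A B by (simp add: parcs_kneser_graph G_def)
      then have "awalk A [(A, B)] B"
        using B[folded G_def] by (simp add: awalk_simps)
      from dist_le[OF this] dist_ge[of 1] pos have "graph_dist G A B = 1"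
        by (force simp: Suc_le_eq one_ereal_def)
      with True show ?thesis
        by (simp add: G_def)
    next
      case ndisj: False
      \<comment> \<open>A walk with a single arc from A to B could only use the arc (A, B), which is
        absent.\<close>
      have "2 \<le> length p" if p: "awalk A p B" for p
      proof -
        have "(A, B) \<notin> parcs G"
          using ndisj by (simp add: parcs_kneser_graph G_def)
        then have "p \<noteq> [e]" for e
          using p by (cases e) (auto simp: awalk_simps)
        with pos[OF p] show ?thesis
          by (cases p; cases "tl p") auto
      qed
      from dist_ge[OF this] have "graph_dist G A B \<ge> 2"
        by simp
      then have "graph_dist G A B \<noteq> 1"
        by auto
      with ndisj show ?thesis
        by (simp add: G_def)
    qed
  qed
qed

text \<open>Distinct lines through \<open>p\<close> share only \<open>p\<close>, so a set avoiding \<open>p\<close> needs a separate point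
  for each of the \<open>t + 1\<close> lines it blocks.\<close>

lemma (in partial_geometry) line_through_point_avoiding_set:
  assumes p: "p \<in> points" "p \<notin> W" and W: "finite W" "card W \<le> t"
  obtains l where "l \<in> lines" "p \<in> l" "l \<inter> W = {}"
proof (rule ccontr)
  assume "\<not> thesis"
  then have "\<forall>l \<in> {l \<in> lines. p \<in> l}. \<exists>q. q \<in> l \<inter> W"
    using that by blast
  from bchoice[OF this] obtain g where g: "\<And>l. l \<in> lines \<Longrightarrow> p \<in> l \<Longrightarrow> g l \<in> l \<inter> W"
    by blast
  \<comment> \<open>If g l = g m, this point of W differs from p, so l and m would share two
    points.\<close>
  have "inj_on g {l \<in> lines. p \<in> l}"
  proof (rule inj_onI, rule ccontr)
    fix l m assume l: "l \<in> {l \<in> lines. p \<in> l}" and m: "m \<in> {l \<in> lines. p \<in> l}"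
      and eq: "g l = g m" and "l \<noteq> m"
    have "{p, g l} \<subseteq> l \<inter> m"
      using g[of l] g[of m] l m eq by auto
    moreover have "finite (l \<inter> m)"
      using l line_subset finite_points by (blast intro: finite_subset)
    ultimately have "card {p, g l} \<le> card (l \<inter> m)"
      by (rule card_mono[rotated])
    moreover have "p \<noteq> g l"
      using g[of l] l p by auto
    ultimately show False
      using lines_meet[of l m] l m \<open>l \<noteq> m\<close> by simp
  qed
  moreover have "g ` {l \<in> lines. p \<in> l} \<subseteq> W"
    using g by auto
  ultimately have "card {l \<in> lines. p \<in> l} \<le> card W"
    using \<open>finite W\<close> by (rule card_inj_on_le)
  then show False
    using card_lines_through p W by simp
qed

theorem theorem4p1:
  fixes P :: "'a set" and L :: "'a set set" and s t \<alpha> v :: nat and f :: "'a \<Rightarrow> nat"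
  assumes "partial_geometry P L s t \<alpha>"
    and "card P = v"
    and "bij_betw f P {1..v}"
    and "t > s"
  shows "resolving_set (kneser_graph v (s + 1)) ((\<lambda>l. f ` l) ` L)"
proof -
  interpret partial_geometry P L s t \<alpha> by fact
  let ?K = "kneser_graph v (s + 1)"
  have inj: "inj_on f P" and im: "f ` P = {1..v}"
    using assms(3) by (auto simp: bij_betw_def)
  have line_vertex: "f ` l \<in> pverts ?K" if "l \<in> L" for l
    using that line_subset[OF that] card_line[OF that] im inj
    by (auto simp: pverts_kneser_graph card_image inj_on_subset)
  have "\<exists>x \<in> (\<lambda>l. f ` l) ` L. graph_dist ?K U x \<noteq> graph_dist ?K W x"
    if U: "U \<in> pverts ?K" and W: "W \<in> pverts ?K" and "U \<noteq> W" for U W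
  proof -
    have card: "card U = s + 1" "card W = s + 1" and sub: "U \<subseteq> {1..v}" "W \<subseteq> {1..v}"
      using U W by (auto simp: pverts_kneser_graph)
    have "finite W"
      using sub by (blast intro: finite_subset)
    then have "\<not> U \<subseteq> W"
      using card card_subset_eq[of W U] \<open>U \<noteq> W\<close> by auto
    moreover have "U \<subseteq> f ` P"
      using sub im by simp
    ultimately obtain p where p: "p \<in> P" "f p \<in> U" "f p \<notin> W"
      by blast
    \<comment> \<open>W lives in {1..v}, so it is pulled back along f to a set of points of the
      geometry.\<close>
    define W' where "W' = {q \<in> P. f q \<in> W}"
    have fin: "finite W'"
      using finite_points by (simp add: W'_def)
    have "card W' \<le> card W"
      using inj \<open>finite W\<close> by (intro card_inj_on_le[of f]) (auto simp: W'_def inj_on_def)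
    \<comment> \<open>Here t > s enters, as s + 1 \<le> t.\<close>
    then have "card W' \<le> t"
      using card \<open>t > s\<close> by simp
    then obtain l where l: "l \<in> L" "p \<in> l" "l \<inter> W' = {}"
      using line_through_point_avoiding_set[of p W'] p fin by (auto simp: W'_def)
    have "W \<inter> f ` l = {}"
      using l line_subset[of l] by (auto simp: W'_def)
    moreover have "U \<inter> f ` l \<noteq> {}"
      using p l by auto
    \<comment> \<open>The line is at distance 1 from W but not from U.\<close>
    ultimately have "graph_dist ?K U (f ` l) \<noteq> graph_dist ?K W (f ` l)"
      using graph_dist_kneser_adjacent_iff[OF _ U line_vertex[OF l(1)]]
        graph_dist_kneser_adjacent_iff[OF _ W line_vertex[OF l(1)]] by auto
    with l show ?thesis
      by blast
  qed
  then show ?thesis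
    using line_vertex unfolding resolving_set_def by blast
qed

end
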